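(* Let $\phi:\mathbb{R}_+\to\mathbb{R}_+$ be an Orlicz function such that $\phi(t)=o(t^2)$ as $t\to 0$. For every $\varepsilon>0$, every $v\in\mathbb{N}$ and every continuous function $\varphi:\partial\mathbb{D}\to\mathbb{C}$, there exist a polynomial $P(z)=\sum_{k=v}^{d}a_kz^k$ with complex coefficients and a compact set $K\subset\partial\mathbb{D}$ with $m(K)>1-\varepsilon$ such that $$\|P\|_{\ell^{\phi}}\le\varepsilon\quad\text{and}\quad\|P-\varphi\|_K\le\varepsilon.$$
   Context: $\mathbb{D}=\{z\in\mathbb{C}:|z|<1\}$ and $\partial\mathbb{D}$ is the unit circle; $m$ is the normalized Lebesgue measure on $\partial\mathbb{D}$, so $m(\partial\mathbb{D})=1$. An Orlicz function is an increasing convex function $\phi:\mathbb{R}_+\to\mathbb{R}_+$ with $\phi(0)=0$, where $\mathbb{R}_+=[0,\infty)$. For $f$ analytic in $\mathbb{D}$, $\hat f(k)$, $k\ge 0$, denotes its $k$-th Fourier (i.e. Taylor) coefficient, so $f(z)=\sum_{k\ge0}\hat f(k)z^k$. The Orlicz space $\ell_a^{\phi}$ is the set of all $f$ analytic in $\mathbb{D}$ with $\sum_k\phi(|\hat f(k)|/\lambda)<+\infty$ for some $\lambda>0$, endowed with the Luxemburg norm $$\|f\|_{\ell^{\phi}}:=\inf\Big\{\lambda>0:\ \sum_k\phi\Big(\frac{|\hat f(k)|}{\lambda}\Big)\le1\Big\}.$$ For a compact set $K\subset\partial\mathbb{D}$ and a continuous function $h$ on $K$, $\|h\|_K:=\sup_{z\in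 K}|h(z)|$. *)

theory Defs
  imports "HOL-Complex_Analysis.Complex_Analysis" "HOL-Library.Landau_Symbols"
begin

text \<open>Functions on \<open>[0, \<infinity>)\<close> are represented by functions on \<^typ>\<open>real\<close> whose values at negative
  arguments are irrelevant. ``Increasing'' is meant in the weak sense.\<close>

definition orlicz_function :: "(real \<Rightarrow> real) \<Rightarrow> bool" where
  "orlicz_function \<phi> \<longleftrightarrow>
     \<phi> ` {0..} \<subseteq> {0..} \<and> mono_on {0..} \<phi> \<and> convex_on {0..} \<phi> \<and> \<phi> 0 = 0"

definition fourier_coeff :: "(complex \<Rightarrow> complex) \<Rightarrow> nat \<Rightarrow> complex" where
  "fourier_coeff f k = fps_nth (fps_expansion f 0) k"

text \<open>The Orlicz space of functions analytic in the unit disc, and its Luxemburg norm. For \<open>f\<close>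
  outside the space the infimum is taken over the empty set and has no meaning.\<close>

definition orlicz_space :: "(real \<Rightarrow> real) \<Rightarrow> (complex \<Rightarrow> complex) set" where
  "orlicz_space \<phi> = {f. f holomorphic_on ball 0 1 \<and>
     (\<exists>c>0. summable (\<lambda>k. \<phi> (cmod (fourier_coeff f k) / c)))}"

definition luxemburg_norm :: "(real \<Rightarrow> real) \<Rightarrow> (complex \<Rightarrow> complex) \<Rightarrow> real" where
  "luxemburg_norm \<phi> f = Inf {c. c > 0 \<and>
     summable (\<lambda>k. \<phi> (cmod (fourier_coeff f k) / c)) \<and>
     (\<Sum>k. \<phi> (cmod (fourier_coeff f k) / c)) \<le> 1}"

text \<open>Normalized Lebesgue measure on the unit circle: the image under \<open>t \<mapsto> exp (\<i> t)\<close> of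
  \<open>dt / (2 \<pi>)\<close> on \<open>[0, 2 \<pi>)\<close>.\<close>

definition circle_measure :: "complex measure" where
  "circle_measure =
     distr (uniform_measure lborel {0..<2 * pi}) (restrict_space borel (sphere 0 1)) cis"

lemma space_circle_measure: "space circle_measure = sphere 0 1"
  by (simp add: circle_measure_def space_restrict_space)

lemma emeasure_circle_measure_sphere: "emeasure circle_measure (sphere 0 1) = 1"
proof -
  have "cis \<in> borel_measurable borel"
    by (intro borel_measurable_continuous_onI continuous_intros)
  then have "cis \<in> borel_measurable (uniform_measure lborel {0..<2 * pi})"
    by (simp cong: measurable_cong_sets)
  then have m: "cis \<in> uniform_measure lborel {0..<2 * pi} \<rightarrow>\<^sub>M restrict_space borel (sphere 0 1)"
    by (intro measurable_restrict_space2) auto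
  have "emeasure circle_measure (sphere 0 1) =
      emeasure (uniform_measure lborel {0..<2 * pi}) (cis -` sphere 0 1 \<inter> UNIV)"
    unfolding circle_measure_def by (subst emeasure_distr[OF m]) (auto simp: sets_restrict_space)
  also have "cis -` sphere 0 1 \<inter> UNIV = UNIV"
    by auto
  also have "emeasure (uniform_measure lborel {0..<2 * pi}) UNIV = 1"
    by (simp add: ennreal_divide_self)
  finally show ?thesis .
qed

definition sup_norm_on :: "complex set \<Rightarrow> (complex \<Rightarrow> complex) \<Rightarrow> real" where
  "sup_norm_on K h = (SUP z\<in>K. cmod (h z))"

end

theory Submission
  imports Defs
begin

text \<open>Unless \<open>\<psi>\<close> is small, a polynomial that is close to \<open>\<psi>\<close> on most of the circle cannot have small
  coefficients in \<open>\<ell>\<^sup>2\<close>. But \<open>\<phi>(t) = o(t\<^sup>2)\<close> asks for less: if the coefficients of \<open>p\<close> are bounded in \<open>\<ell>\<^sup>2\<close> by a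
  constant and are all sufficiently small compared with that constant, then the Luxemburg norm of
  \<open>p\<close> is small (\<open>luxemburg_norm_poly_le\<close>). Moreover it is enough to treat \<open>\<psi> = 1\<close>: by
  Stone--Weierstrass \<open>\<psi>\<close> is close to a trigonometric polynomial \<open>z\<^bsup>-M\<^esup> q(z)\<close>, and if \<open>Q\<close> has only
  frequencies from \<open>M + v\<close> on and is close to \<open>1\<close> on \<open>K\<close>, then \<open>z\<^bsup>-M\<^esup> q(z) Q(z)\<close> is close to \<open>\<psi>\<close> on \<open>K\<close>,
  while its sup norm and its largest coefficient exceed those of \<open>Q\<close> at most by a factor that depends
  only on \<open>q\<close>. So for every \<open>d > 0\<close> there must be a bound \<open>R\<close> such that one can find polynomials
  \<open>Q = 1 - g\<close> with \<open>|g| < R\<close> on the circle, \<open>|g| \<le> 2 d\<close> on a large part of it, and coefficients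
  that are as small as desired (\<open>flat_polynomial_near_one\<close>).

  The polynomial \<open>g\<close> imitates a planar Brownian motion that starts at \<open>1\<close> and is stopped when it
  leaves the annulus \<open>d < |w| < R\<close>. By recurrence this motion leaves through the
  inner circle with probability close to \<open>1\<close> if \<open>R\<close> is large. A step of the walk adds
  to \<open>g\<close> a block of frequencies higher than all earlier ones, of the shape \<open>\<eta> z\<^bsup>N\<^esup> \<theta>(|g(z)|)\<close>, where
  \<open>\<theta>\<close> is the distance to the boundary of the annulus. Since the blocks are disjoint, the
  coefficients of \<open>g - 1\<close> never exceed \<open>2 \<eta> R\<close>. Two integrals over the circle
  replace probability theory. First, the mean of \<open>|g|\<^sup>2\<close> grows at each step by at
  least \<open>\<eta>\<^sup>2 / 4\<close> times the mean of \<open>\<theta>(|g|)\<^sup>2\<close> and stays below \<open>R\<^sup>2\<close>, so at some time the mean of \<open>\<theta>(|g|)\<^sup>2\<close> is tiny: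
  on most of the circle \<open>|g|\<close> is near \<open>d\<close> or near \<open>R\<close> (\<open>annulus_walk_mostly_stopped\<close>).
  Second, \<open>g\<close> never acquires a zero in the disc, as in Rouche's theorem, so \<open>ln |g|\<close> is harmonic there
  and its mean over the circle remains \<open>ln |g(0)| = 0\<close>. Then the set where \<open>|g|\<close> is near \<open>R\<close> has
  measure about \<open>ln (1/d) / ln (R/d)\<close> at most, which is small for large \<open>R\<close>
  (\<open>annulus_walk_measure\<close>).\<close>

section \<open>Mean values on the circle\<close>

lemma cis_measurable_circle:
  "cis \<in> uniform_measure lborel {0..<2 * pi} \<rightarrow>\<^sub>M restrict_space borel (sphere 0 1)"
proof -
  have "cis \<in> borel_measurable borel"
    by (intro borel_measurable_continuous_onI continuous_intros)
  then have "cis \<in> borel_measurable (uniform_measure lborel {0..<2 * pi})"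
    by (simp cong: measurable_cong_sets)
  then show ?thesis
    by (intro measurable_restrict_space2) auto
qed

interpretation circle: finite_measure circle_measure
  by standard (simp add: space_circle_measure emeasure_circle_measure_sphere)

lemma measure_circle_sphere [simp]: "measure circle_measure (sphere 0 1) = 1"
  by (simp add: measure_def emeasure_circle_measure_sphere)

lemma borel_measurable_circle_continuous:
  fixes f :: "complex \<Rightarrow> 'a::topological_space"
  assumes "continuous_on (sphere 0 1) f"
  shows "f \<in> borel_measurable circle_measure"
proof -
  have "f \<in> borel_measurable (restrict_space borel (sphere 0 1))"
    using assms by (rule borel_measurable_continuous_on_restrict)
  then show ?thesis
    by (simp add: circle_measure_def cong: measurable_cong_sets)
qed

lemma integrable_circle_continuous:
  fixes f :: "complex \<Rightarrow> 'a::{banach,second_countable_topology}"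
  assumes "continuous_on (sphere 0 1) f"
  shows "integrable circle_measure f"
proof -
  have "compact (f ` sphere 0 1)"
    using assms by (intro compact_continuous_image) auto
  then obtain B where B: "\<forall>z\<in>sphere 0 1. norm (f z) \<le> B"
    using compact_imp_bounded bounded_iff by (metis imageI)
  show ?thesis
    using B by (intro circle.integrable_const_bound[of _ B] borel_measurable_circle_continuous assms)
      (auto intro!: AE_I2 simp: space_circle_measure)
qed

text \<open>Parametrised by \<open>cis\<close>, Cauchy's formula at the centre of the disc is the mean value property.
  Orthogonality of the powers of \<open>z\<close> and the invariance of the mean of \<open>ln |g|\<close> both
  come from it.\<close>

lemma circle_mean_value:
  fixes F :: "complex \<Rightarrow> complex"
  assumes cont: "continuous_on (cball 0 1) F" and holo: "F holomorphic_on ball 0 1"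
  shows "(\<integral>z. F z \<partial>circle_measure) = F 0"
proof -
  have contS: "continuous_on (sphere 0 1) F"
    by (rule continuous_on_subset[OF cont]) auto
  have contcis: "continuous_on A (\<lambda>t. F (cis t))" for A
    by (rule continuous_on_compose2[OF contS]) (auto intro!: continuous_intros)
  have "((\<lambda>u. F u / (u - 0)) has_contour_integral (2 * of_real pi * \<i> * F 0)) (circlepath 0 1)"
    using assms by (intro Cauchy_integral_circlepath) auto
  then have "((\<lambda>t. F (cis t) / cis t * \<i> * cis t) has_integral 2 * of_real pi * \<i> * F 0) {0..2*pi}"
    unfolding circlepath_def by (subst (asm) has_contour_integral_part_circlepath_iff) auto
  then have "((\<lambda>t. (-\<i>) * (F (cis t) / cis t * \<i> * cis t)) has_integral (-\<i>) * (2 * of_real pi * \<i> * F 0)) {0..2*pi}"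
    by (rule has_integral_mult_right)
  moreover have "(-\<i>) * (F (cis t) / cis t * \<i> * cis t) = F (cis t)" for t
    by (simp add: field_simps)
  moreover have "(-\<i>) * (2 * of_real pi * \<i> * F 0) = 2 * of_real pi * F 0"
    by (simp add: field_simps)
  ultimately have "((\<lambda>t. F (cis t)) has_integral 2 * of_real pi * F 0) {0..2*pi}"
    by (simp only:)
  then have I: "((\<lambda>t. F (cis t)) has_integral 2 * of_real pi * F 0) {0..<2*pi}"
    by (rule has_integral_spike_set_eq[THEN iffD1, rotated 2])
      (auto intro: negligible_subset[of "{2*pi}"])
  have si: "set_integrable lborel {0..<2*pi} (\<lambda>t. F (cis t))"
    by (rule set_integrable_subset[OF borel_integrable_atLeastAtMost'[OF contcis, of 0 "2*pi"]]) auto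
  have meas: "(\<lambda>t. F (cis t)) \<in> borel_measurable lborel"
    using borel_measurable_continuous_onI[OF contcis] by simp
  have "(\<integral>z. F z \<partial>circle_measure) = (\<integral>t. F (cis t) \<partial>uniform_measure lborel {0..<2*pi})"
    unfolding circle_measure_def
    by (rule integral_distr[OF cis_measurable_circle])
      (rule borel_measurable_continuous_on_restrict[OF contS])
  also have "uniform_measure lborel {0..<2*pi} = density lborel (\<lambda>t. ennreal (indicator {0..<2*pi} t / (2*pi)))"
    unfolding uniform_measure_def
    by (intro density_cong) (auto simp: indicator_def divide_ennreal[symmetric] ennreal_1)
  also have "(\<integral>t. F (cis t) \<partial>\<dots>) = (\<integral>t. (indicator {0..<2*pi} t / (2*pi)) *\<^sub>R F (cis t) \<partial>lborel)"
    using meas by (intro integral_density) auto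
  also have "\<dots> = (\<integral>t. (1 / (2*pi)) *\<^sub>R (indicator {0..<2*pi} t *\<^sub>R F (cis t)) \<partial>lborel)"
    by (intro Bochner_Integration.integral_cong) auto
  also have "\<dots> = (1 / (2*pi)) *\<^sub>R set_lebesgue_integral lborel {0..<2*pi} (\<lambda>t. F (cis t))"
    unfolding set_lebesgue_integral_def by (rule integral_scaleR_right) 
  also have "set_lebesgue_integral lborel {0..<2*pi} (\<lambda>t. F (cis t)) = 2 * of_real pi * F 0"
    using set_borel_integral_eq_integral(2)[OF si] I by (simp add: integral_unique)
  finally show ?thesis
    by (simp add: scaleR_conv_of_real)
qed

section \<open>The mean square of a polynomial\<close>

definition circle_energy :: "complex poly \<Rightarrow> real" where
  "circle_energy p = (\<integral>z. (cmod (poly p z))\<^sup>2 \<partial>circle_measure)"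

text \<open>The cross term of \<open>|a + z p(z)|\<^sup>2\<close> is the real part of \<open>2 cnj a z p(z)\<close>, which vanishes at \<open>0\<close> and
  therefore has mean \<open>0\<close>. Peeling off one coefficient at a time makes Parseval's identity and the
  orthogonality of disjoint blocks inductions on \<^const>\<open>pCons\<close>.\<close>

lemma circle_energy_pCons: "circle_energy (pCons a p) = (cmod a)\<^sup>2 + circle_energy p"
proof -
  have int: "integrable circle_measure (\<lambda>z. cnj a * (z * poly p z))"
    by (intro integrable_circle_continuous continuous_intros)
  have zero: "(\<integral>z. cnj a * (z * poly p z) \<partial>circle_measure) = 0"
    by (subst circle_mean_value) (auto intro!: continuous_intros holomorphic_intros)
  have "circle_energy (pCons a p) =
      (\<integral>z. (cmod a)\<^sup>2 + (cmod (poly p z))\<^sup>2 + 2 * Re (cnj a * (z * poly p z)) \<partial>circle_measure)"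
    unfolding circle_energy_def
  proof (rule Bochner_Integration.integral_cong[OF refl])
    fix z assume "z \<in> space circle_measure"
    then have z: "cmod z = 1" by (simp add: space_circle_measure)
    have "(cmod (a + z * poly p z))\<^sup>2 = (cmod a)\<^sup>2 + (cmod (z * poly p z))\<^sup>2 + 2 * Re (cnj a * (z * poly p z))"
      unfolding cmod_power2 by (simp add: algebra_simps power2_eq_square)
    with z show "(cmod (poly (pCons a p) z))\<^sup>2 =
        (cmod a)\<^sup>2 + (cmod (poly p z))\<^sup>2 + 2 * Re (cnj a * (z * poly p z))"
      by (simp add: norm_mult)
  qed
  also have "\<dots> = (\<integral>z. (cmod a)\<^sup>2 + (cmod (poly p z))\<^sup>2 \<partial>circle_measure)
      + (\<integral>z. 2 * Re (cnj a * (z * poly p z)) \<partial>circle_measure)"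
    by (intro Bochner_Integration.integral_add integrable_circle_continuous continuous_intros)
  also have "(\<integral>z. (cmod a)\<^sup>2 + (cmod (poly p z))\<^sup>2 \<partial>circle_measure)
      = (\<integral>z. (cmod a)\<^sup>2 \<partial>circle_measure) + circle_energy p"
    unfolding circle_energy_def
    by (intro Bochner_Integration.integral_add integrable_circle_continuous continuous_intros)
  also have "(\<integral>z. 2 * Re (cnj a * (z * poly p z)) \<partial>circle_measure) = 0"
    using integral_Re[OF int] zero by (simp only: integral_mult_right_zero) simp
  finally show ?thesis by (simp add: space_circle_measure)
qed

lemma circle_energy_parseval:
  "degree p < n \<Longrightarrow> circle_energy p = (\<Sum>k<n. (cmod (coeff p k))\<^sup>2)"
proof (induction n arbitrary: p)
  case (Suc n)
  obtain a q where p: "p = pCons a q" by (cases p)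
  show ?case
  proof (cases "q = 0")
    case True
    have "circle_energy 0 = 0" by (simp add: circle_energy_def)
    with True p show ?thesis 
      by (simp add: circle_energy_pCons sum.lessThan_Suc_shift del: sum.lessThan_Suc)
  next
    case False
    with Suc.prems p have "degree q < n" by simp
    with Suc.IH p show ?thesis
      by (simp add: circle_energy_pCons sum.lessThan_Suc_shift del: sum.lessThan_Suc)
  qed
qed auto

lemma circle_energy_disjoint_blocks:
  "degree g < n \<Longrightarrow> circle_energy (g + monom 1 n * r) = circle_energy g + circle_energy (monom 1 n * r)"
proof (induction n arbitrary: g)
  case (Suc n)
  obtain a q where p: "g = pCons a q" by (cases g)
  have m: "monom 1 (Suc n) * r = pCons 0 (monom 1 n * r)"
    by (simp add: monom_Suc)
  have "circle_energy (q + monom 1 n * r) = circle_energy q + circle_energy (monom 1 n * r)"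
  proof (cases "q = 0")
    case True
    have "circle_energy 0 = 0" by (simp add: circle_energy_def)
    with True show ?thesis by simp
  next
    case False
    with Suc.prems p have "degree q < n" by simp
    then show ?thesis by (rule Suc.IH)
  qed
  then show ?case
    by (simp add: p m circle_energy_pCons)
qed auto

lemma circle_energy_le:
  assumes "\<And>z. cmod z = 1 \<Longrightarrow> cmod (poly p z) \<le> B"
  shows "circle_energy p \<le> B\<^sup>2"
proof -
  have "circle_energy p \<le> (\<integral>z. B\<^sup>2 \<partial>circle_measure)"
    unfolding circle_energy_def
    by (intro integral_mono integrable_circle_continuous continuous_intros)
       (auto simp: space_circle_measure intro!: power_mono assms)
  then show ?thesis
    by (simp add: space_circle_measure)
qed

lemma coeff_le_sup_on_circle:
  assumes "\<And>z. cmod z = 1 \<Longrightarrow> cmod (poly p z) \<le> B"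
  shows "cmod (coeff p k) \<le> B"
proof -
  have "cmod 1 = 1" by simp
  then have "0 \<le> B" using assms norm_ge_zero order_trans by blast
  have "(cmod (coeff p k))\<^sup>2 \<le> (\<Sum>j<Suc (max k (degree p)). (cmod (coeff p j))\<^sup>2)"
    by (rule member_le_sum) auto
  also have "\<dots> = circle_energy p"
    by (rule circle_energy_parseval[symmetric]) auto
  also have "\<dots> \<le> B\<^sup>2" by (rule circle_energy_le[OF assms])
  finally show ?thesis using \<open>0 \<le> B\<close> by (rule power2_le_imp_le)
qed

section \<open>Trigonometric approximation\<close>

text \<open>On the circle \<open>2 z Re z = z\<^sup>2 + 1\<close> and \<open>2 \<i> z Im z = z\<^sup>2 - 1\<close>, so a polynomial in the real and
  imaginary parts is a trigonometric polynomial. A trigonometric polynomial is represented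
  by its product with a power of \<open>z\<close> that clears the negative frequencies; on the circle this does
  not change absolute values, and it keeps everything within \<^typ>\<open>complex poly\<close>.\<close>

lemma real_polynomial_function_circle:
  fixes f :: "complex \<Rightarrow> real"
  assumes "real_polynomial_function f"
  shows "\<exists>q M. \<forall>z\<in>sphere 0 1. poly q z = z ^ M * of_real (f z)"
  using assms
proof induction
  case (linear f)
  then interpret bounded_linear f .
  have eq: "poly [:(f 1 + \<i> * f \<i>) / 2, 0, (f 1 - \<i> * f \<i>) / 2:] z = z ^ 1 * of_real (f z)" 
    if "z \<in> sphere 0 1" for z
  proof -
    have "f z = f (Re z *\<^sub>R 1 + Im z *\<^sub>R \<i>)"
      by (rule arg_cong[of _ _ f]) (simp add: complex_eq_iff)
    also have "\<dots> = Re z * f 1 + Im z * f \<i>"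
      by (simp only: add scale) simp
    finally have fz: "f z = Re z * f 1 + Im z * f \<i>" .
    have n: "(Re z)\<^sup>2 + (Im z)\<^sup>2 = 1"
      using that cmod_power2[of z] by simp
    have n2: "Re z * (Re z * t) = t - Im z * (Im z * t)" for t
    proof -
      have "(Re z)\<^sup>2 = 1 - (Im z)\<^sup>2" using n by simp
      then have "(Re z)\<^sup>2 * t = (1 - (Im z)\<^sup>2) * t" by simp
      then show ?thesis by (simp add: power2_eq_square algebra_simps)
    qed
    show ?thesis
      unfolding fz by (simp add: complex_eq_iff field_simps n2)
  qed
  then show ?case by blast
next
  case (const c)
  have "\<forall>z\<in>sphere 0 1. poly [:of_real c:] z = z ^ 0 * of_real c" by simp
  then show ?case by blast
next
  case (add f g)
  then obtain q M r N where "\<forall>z\<in>sphere 0 1. poly q z = z ^ M * of_real (f z)"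
    "\<forall>z\<in>sphere 0 1. poly r z = z ^ N * of_real (g z)" by blast
  then have "\<forall>z\<in>sphere 0 1. poly (monom 1 N * q + monom 1 M * r) z = z ^ (M + N) * of_real (f z + g z)"
    by (simp add: poly_monom power_add algebra_simps)
  then show ?case by blast
next
  case (mult f g)
  then obtain q M r N where "\<forall>z\<in>sphere 0 1. poly q z = z ^ M * of_real (f z)"
    "\<forall>z\<in>sphere 0 1. poly r z = z ^ N * of_real (g z)" by blast
  then have "\<forall>z\<in>sphere 0 1. poly (q * r) z = z ^ (M + N) * of_real (f z * g z)"
    by (simp add: power_add algebra_simps)
  then show ?case by blast
qed

lemma trig_polynomial_approximation:
  assumes "continuous_on (sphere 0 1) (h :: complex \<Rightarrow> complex)" "\<kappa> > 0"
  shows "\<exists>q M. \<forall>z\<in>sphere 0 1. cmod (poly q z - z ^ M * h z) < \<kappa>"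
proof -
  obtain f where f: "polynomial_function f" "\<forall>z\<in>sphere 0 1. cmod (h z - f z) < \<kappa>"
    using Stone_Weierstrass_polynomial_function[of "sphere 0 1" h \<kappa>] assms by auto
  have "real_polynomial_function (\<lambda>z. Re (f z))" "real_polynomial_function (\<lambda>z. Im (f z))"
    using f(1) bounded_linear_Re bounded_linear_Im unfolding polynomial_function_def o_def by blast+
  from this[THEN real_polynomial_function_circle]
  obtain q M r N where qr: "\<forall>z\<in>sphere 0 1. poly q z = z ^ M * of_real (Re (f z))"
    "\<forall>z\<in>sphere 0 1. poly r z = z ^ N * of_real (Im (f z))"
    by blast
  have "cmod (poly (monom 1 N * q + monom \<i> M * r) z - z ^ (M + N) * h z) < \<kappa>" if z: "z \<in> sphere 0 1" for z
  proof -
    have "poly (monom 1 N * q + monom \<i> M * r) z = z ^ (M + N) * (Re (f z) + \<i> * Im (f z))"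
      using qr z by (simp add: poly_monom power_add algebra_simps)
    also have "\<dots> = z ^ (M + N) * f z" by (simp only: complex_eq[symmetric])
    finally have "cmod (poly (monom 1 N * q + monom \<i> M * r) z - z ^ (M + N) * h z) = cmod (z ^ (M + N) * (f z - h z))"
      by (simp add: algebra_simps)
    also have "\<dots> = cmod (h z - f z)"
      using z by (simp add: norm_mult norm_power norm_minus_commute)
    finally show ?thesis using f z by simp
  qed
  then show ?thesis by blast
qed

section \<open>A random walk in an annulus\<close>

definition annulus_cutoff :: "real \<Rightarrow> real \<Rightarrow> real \<Rightarrow> real" where
  "annulus_cutoff d R u = min (u - d) (R - u)"

text \<open>The states of the walk. Starting from the constant \<open>1\<close>, coefficients at positive frequencies
  below \<open>v\<close> stay zero and the others stay bounded by \<open>b\<close>; freedom from zeros in the closed disc is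
  what preserves the mean of \<open>ln |g|\<close> in the next step.\<close>

definition annulus_walk :: "real \<Rightarrow> real \<Rightarrow> real \<Rightarrow> nat \<Rightarrow> complex poly \<Rightarrow> bool" where
  "annulus_walk d R b v g \<longleftrightarrow>
     (\<forall>z\<in>cball 0 1. poly g z \<noteq> 0) \<and>
     (\<forall>z\<in>sphere 0 1. d < cmod (poly g z) \<and> cmod (poly g z) < R) \<and>
     (\<integral>z. ln (cmod (poly g z)) \<partial>circle_measure) = 0 \<and>
     coeff g 0 = 1 \<and>
     (\<forall>k. 0 < k \<and> k < v \<longrightarrow> coeff g k = 0) \<and>
     (\<forall>k>0. cmod (coeff g k) \<le> b)"

text \<open>The values of \<open>1 + s\<close> have positive real part, so the principal logarithm of \<open>1 + s\<close> is
  holomorphic and its mean is \<open>Ln 1 = 0\<close>.\<close>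

lemma integral_ln_one_plus_eq_0:
  assumes cont: "continuous_on (cball 0 1) s" and holo: "s holomorphic_on ball 0 1"
    and bound: "\<And>z. z \<in> cball 0 1 \<Longrightarrow> cmod (s z) < 1" and "s 0 = 0"
  shows "(\<integral>z. ln (cmod (1 + s z)) \<partial>circle_measure) = 0"
proof -
  have Re: "Re (1 + s z) > 0" if "z \<in> cball 0 1" for z
    using bound[OF that] abs_Re_le_cmod[of "s z"] by simp
  have nonpos: "1 + s z \<notin> \<real>\<^sub>\<le>\<^sub>0" if "z \<in> cball 0 1" for z
    using Re[OF that] by (auto simp: complex_nonpos_Reals_iff)
  have contLn: "continuous_on (cball 0 1) (\<lambda>z. Ln (1 + s z))"
    using nonpos by (intro continuous_intros cont) 
  have "(\<integral>z. Ln (1 + s z) \<partial>circle_measure) = Ln (1 + s 0)"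
    using nonpos by (intro circle_mean_value contLn holomorphic_intros holo) auto
  then have zero: "(\<integral>z. Ln (1 + s z) \<partial>circle_measure) = 0"
    by (simp add: \<open>s 0 = 0\<close>)
  have int: "integrable circle_measure (\<lambda>z. Ln (1 + s z))"
    by (intro integrable_circle_continuous continuous_on_subset[OF contLn]) auto
  have "(\<integral>z. ln (cmod (1 + s z)) \<partial>circle_measure) = (\<integral>z. Re (Ln (1 + s z)) \<partial>circle_measure)"
  proof (rule Bochner_Integration.integral_cong[OF refl])
    fix z assume "z \<in> space circle_measure"
    then have "z \<in> cball 0 1" by (simp add: space_circle_measure)
    from Re[OF this] have "1 + s z \<noteq> 0" by fastforce
    then show "ln (cmod (1 + s z)) = Re (Ln (1 + s z))" by simp
  qed
  then show ?thesis using integral_Re[OF int] zero by simp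
qed

text \<open>One step. The increment \<open>q\<close> satisfies \<open>\<eta> \<theta> / 2 \<le> |q| \<le> 3 \<theta> / 4\<close> on the circle, with \<open>\<theta>\<close> the
  distance of \<open>|g|\<close> to the boundary of the interval from \<open>d\<close> to \<open>R\<close>. The upper bound keeps the walk in the annulus and
  makes \<open>s = q / g\<close> smaller than \<open>1\<close> on the circle, hence on the disc by the maximum modulus
  principle, so that \<open>g + q = g (1 + s)\<close> has no zeros either. The lower bound gives
  the growth of energy.\<close>

lemma annulus_walk_step:
  assumes walk: "annulus_walk d R b v g" and "0 < d" and \<eta>: "0 < \<eta>" "\<eta> \<le> 1 / 2" "2 * \<eta> * R \<le> b"
  obtains g' where "annulus_walk d R b v g'"
    "circle_energy g + (\<eta> / 2)\<^sup>2 * (\<integral>z. (annulus_cutoff d R (cmod (poly g z)))\<^sup>2 \<partial>circle_measure)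
       \<le> circle_energy g'"
proof -
  have nz: "\<And>z. z \<in> cball 0 1 \<Longrightarrow> poly g z \<noteq> 0"
    and ann: "\<And>z. cmod z = 1 \<Longrightarrow> d < cmod (poly g z) \<and> cmod (poly g z) < R"
    and log: "(\<integral>z. ln (cmod (poly g z)) \<partial>circle_measure) = 0"
    and c0: "coeff g 0 = 1"
    and clow: "\<And>k. 0 < k \<Longrightarrow> k < v \<Longrightarrow> coeff g k = 0"
    and cb: "\<And>k. 0 < k \<Longrightarrow> cmod (coeff g k) \<le> b"
    using walk by (auto simp: annulus_walk_def)
  define \<theta> where "\<theta> z = annulus_cutoff d R (cmod (poly g z))" for z
  have cont\<theta>: "continuous_on A \<theta>" for A
    unfolding \<theta>_def annulus_cutoff_def by (intro continuous_intros)
  have \<theta>_pos: "0 < \<theta> z" and \<theta>_le: "\<theta> z \<le> cmod (poly g z) - d" "\<theta> z \<le> R - cmod (poly g z)" 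
    if "cmod z = 1" for z
    using ann[OF that] by (auto simp: \<theta>_def annulus_cutoff_def)
  \<comment> \<open>By compactness \<open>\<theta>\<close> has a positive minimum, so an error below half of it is a relative error
    of at most one half at every point.\<close>
  obtain z0 :: complex where z0: "cmod z0 = 1" "\<And>z. cmod z = 1 \<Longrightarrow> \<theta> z0 \<le> \<theta> z"
    using continuous_attains_inf[OF _ _ cont\<theta>, of "sphere 0 1"] by force
  have "continuous_on (sphere 0 1) (\<lambda>z. complex_of_real (\<theta> z))"
    by (intro continuous_intros cont\<theta>)
  then obtain q0 M where q0: "\<And>z. cmod z = 1 \<Longrightarrow> cmod (poly q0 z - z ^ M * \<theta> z) < \<theta> z0 / 2"
    using trig_polynomial_approximation[of "\<lambda>z. of_real (\<theta> z)" "\<theta> z0 / 2"] \<theta>_pos[OF z0(1)]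
    by (metis half_gt_zero mem_sphere_0)
  have q0b: "\<theta> z / 2 \<le> cmod (poly q0 z)" "cmod (poly q0 z) \<le> 3 / 2 * \<theta> z" if z: "cmod z = 1" for z
  proof -
    have 1: "cmod (z ^ M * \<theta> z) = \<theta> z" using z \<theta>_pos[OF z] by (simp add: norm_mult norm_power)
    have 2: "cmod (poly q0 z - z ^ M * \<theta> z) \<le> \<theta> z / 2" using q0[OF z] z0(2)[OF z] by simp
    show "\<theta> z / 2 \<le> cmod (poly q0 z)" "cmod (poly q0 z) \<le> 3 / 2 * \<theta> z"
      using 1 2 norm_triangle_ineq2[of "poly q0 z" "z ^ M * \<theta> z"]
        norm_triangle_ineq2[of "z ^ M * \<theta> z" "poly q0 z"]
      by (simp_all add: norm_minus_commute)
  qed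
  \<comment> \<open>The shift by \<open>n\<close> moves the new block above all frequencies in use, to at least \<open>v\<close>, and
    makes it vanish at \<open>0\<close>.\<close>
  define n where "n = max v (Suc (degree g))"
  define q where "q = monom 1 n * smult (of_real \<eta>) q0"
  have n: "v \<le> n" "degree g < n" "0 < n" by (auto simp: n_def)
  have norm_q: "cmod (poly q z) = \<eta> * cmod (poly q0 z)" if "cmod z = 1" for z
    using that \<eta>(1) by (simp add: q_def poly_monom norm_mult norm_power)
  have q_le: "cmod (poly q z) \<le> 3 / 4 * \<theta> z" if "cmod z = 1" for z
  proof -
    have "\<eta> * cmod (poly q0 z) \<le> 1 / 2 * (3 / 2 * \<theta> z)"
      using \<eta> q0b[OF that] \<theta>_pos[OF that] by (intro mult_mono) auto
    then show ?thesis using norm_q[OF that] by simp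
  qed
  have q_ge: "\<eta> / 2 * \<theta> z \<le> cmod (poly q z)" if "cmod z = 1" for z
    using norm_q[OF that] q0b(1)[OF that] \<eta>(1) by (simp add: field_simps)
  have coeff_q: "coeff q k = 0" if "k < n" for k
    using that by (simp add: q_def coeff_monom_mult)
  have "0 < R" using ann[of 1] \<open>0 < d\<close> by simp
  have coeff_q_le: "cmod (coeff q k) \<le> b" for k
  proof (rule coeff_le_sup_on_circle)
    fix z :: complex assume z: "cmod z = 1"
    have "\<eta> * cmod (poly q0 z) \<le> \<eta> * (3 / 2 * \<theta> z)"
      using \<eta> q0b[OF z] by (intro mult_left_mono) auto
    also have "\<dots> \<le> \<eta> * (2 * R)"
      using \<eta> \<theta>_le[OF z] \<theta>_pos[OF z] norm_ge_zero[of "poly g z"] \<open>0 < R\<close> 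
      by (intro mult_left_mono) linarith+
    finally show "cmod (poly q z) \<le> b" using norm_q[OF z] \<eta>(3) by simp
  qed
  define s where "s z = poly q z / poly g z" for z
  have conts: "continuous_on (cball 0 1) s"
    unfolding s_def using nz by (intro continuous_intros) auto
  have holos: "s holomorphic_on ball 0 1"
    unfolding s_def using nz by (intro holomorphic_intros) auto
  have s_small: "cmod (s z) \<le> 3 / 4" if "z \<in> cball 0 1" for z
  proof (rule maximum_modulus_frontier[OF _ _ _ _ that])
    show "s holomorphic_on interior (cball 0 1)" "continuous_on (closure (cball 0 1)) s"
      using holos conts by simp_all
    fix w :: complex assume "w \<in> frontier (cball 0 1)"
    then have w: "cmod w = 1" by simp
    have "cmod (poly q w) \<le> 3 / 4 * cmod (poly g w)"
      using q_le[OF w] \<theta>_le(1)[OF w] \<open>0 < d\<close> by linarith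
    moreover have "0 < cmod (poly g w)" using ann[OF w] \<open>0 < d\<close> by linarith
    ultimately show "cmod (s w) \<le> 3 / 4"
      unfolding s_def norm_divide by (subst pos_divide_le_eq)
  qed auto
  have g': "poly (g + q) z = poly g z * (1 + s z)" if "z \<in> cball 0 1" for z
    using nz[OF that] by (simp add: s_def field_simps)
  have s_nz: "1 + s z \<noteq> 0" if "z \<in> cball 0 1" for z
  proof
    assume "1 + s z = 0"
    then have "s z = -1" by (simp add: add_eq_0_iff)
    then show False using s_small[OF that] by simp
  qed
  have "(\<integral>z. ln (cmod (poly (g + q) z)) \<partial>circle_measure)
      = (\<integral>z. ln (cmod (poly g z)) + ln (cmod (1 + s z)) \<partial>circle_measure)"
  proof (rule Bochner_Integration.integral_cong[OF refl])
    fix z assume "z \<in> space circle_measure"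
    then have z: "z \<in> cball 0 1" by (simp add: space_circle_measure)
    show "ln (cmod (poly (g + q) z)) = ln (cmod (poly g z)) + ln (cmod (1 + s z))"
      unfolding g'[OF z] norm_mult using nz[OF z] s_nz[OF z] by (intro ln_mult_pos) auto
  qed
  also have "\<dots> = (\<integral>z. ln (cmod (poly g z)) \<partial>circle_measure) + (\<integral>z. ln (cmod (1 + s z)) \<partial>circle_measure)"
    using nz s_nz
    by (intro Bochner_Integration.integral_add integrable_circle_continuous continuous_intros
        continuous_on_subset[OF conts]) auto
  also have "(\<integral>z. ln (cmod (1 + s z)) \<partial>circle_measure) = 0"
  proof (rule integral_ln_one_plus_eq_0[OF conts holos])
    show "s 0 = 0" using n by (simp add: s_def q_def poly_monom)
    show "cmod (s z) < 1" if "z \<in> cball 0 1" for z using s_small[OF that] by simp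
  qed
  finally have log': "(\<integral>z. ln (cmod (poly (g + q) z)) \<partial>circle_measure) = 0" by (simp add: log)
  have ann': "d < cmod (poly (g + q) z) \<and> cmod (poly (g + q) z) < R" if z: "cmod z = 1" for z
    using q_le[OF z] \<theta>_le[OF z] \<theta>_pos[OF z] norm_triangle_ineq[of "poly g z" "poly q z"]
      norm_triangle_ineq2[of "poly g z" "- poly q z"] by simp
  have "annulus_walk d R b v (g + q)"
    unfolding annulus_walk_def
  proof (intro conjI allI impI ballI)
    fix k :: nat assume k: "0 < k"
    show "cmod (coeff (g + q) k) \<le> b"
    proof (cases "k < n")
      case True
      then show ?thesis using cb[OF k] by (simp add: coeff_q)
    next
      case False
      then have "coeff g k = 0" using n by (intro coeff_eq_0) simp
      then show ?thesis using coeff_q_le by simp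
    qed
  qed (use log' ann' g' nz s_nz c0 clow coeff_q n in auto)
  moreover have "circle_energy g + (\<eta> / 2)\<^sup>2 * (\<integral>z. (\<theta> z)\<^sup>2 \<partial>circle_measure) \<le> circle_energy (g + q)"
  proof -
    have "(\<eta> / 2)\<^sup>2 * (\<integral>z. (\<theta> z)\<^sup>2 \<partial>circle_measure) = (\<integral>z. (\<eta> / 2 * \<theta> z)\<^sup>2 \<partial>circle_measure)"
      by (simp add: power_mult_distrib power_divide)
    also have "\<dots> \<le> circle_energy q"
      unfolding circle_energy_def
    proof (intro integral_mono integrable_circle_continuous continuous_intros cont\<theta>)
      fix z assume "z \<in> space circle_measure"
      then have z: "cmod z = 1" by (simp add: space_circle_measure)
      show "(\<eta> / 2 * \<theta> z)\<^sup>2 \<le> (cmod (poly q z))\<^sup>2"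
        using q_ge[OF z] \<theta>_pos[OF z] \<eta> by (intro power_mono) auto
    qed
    also have "circle_energy (g + q) = circle_energy g + circle_energy q"
      unfolding q_def by (rule circle_energy_disjoint_blocks[OF n(2)])
    ultimately show ?thesis by simp
  qed
  ultimately show ?thesis using that unfolding \<theta>_def by blast
qed

text \<open>If the walk were never mostly stopped, each step would raise the energy by a fixed amount,
  but the energy is at most \<open>R\<^sup>2\<close>.\<close>

lemma annulus_walk_mostly_stopped:
  assumes d: "0 < d" "d < 1" and R: "1 < R" and "0 < b" "0 < \<sigma>"
  obtains g where "annulus_walk d R b v g"
    "(\<integral>z. (annulus_cutoff d R (cmod (poly g z)))\<^sup>2 \<partial>circle_measure) \<le> \<sigma>"
proof (rule ccontr)
  assume "\<not> thesis"
  with that have big: "\<And>g. annulus_walk d R b v g \<Longrightarrow>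
    \<sigma> < (\<integral>z. (annulus_cutoff d R (cmod (poly g z)))\<^sup>2 \<partial>circle_measure)"
    by (meson not_le)
  define \<eta> where "\<eta> = min (1 / 2) (b / (2 * R))"
  have \<eta>: "0 < \<eta>" "\<eta> \<le> 1 / 2" "2 * \<eta> * R \<le> b"
  proof -
    have "\<eta> \<le> b / (2 * R)" by (simp add: \<eta>_def)
    then show "2 * \<eta> * R \<le> b" using R by (simp add: field_simps)
  qed (use R \<open>0 < b\<close> in \<open>auto simp: \<eta>_def\<close>)
  define \<delta> where "\<delta> = (\<eta> / 2)\<^sup>2 * \<sigma>"
  have "0 < \<delta>" using \<eta> \<open>0 < \<sigma>\<close> by (simp add: \<delta>_def)
  have grow: "\<exists>g. annulus_walk d R b v g \<and> real j * \<delta> \<le> circle_energy g" for j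
  proof (induction j)
    case 0
    have "annulus_walk d R b v 1"
      using d R \<open>0 < b\<close> by (auto simp: annulus_walk_def)
    moreover have "0 \<le> circle_energy 1" by (simp add: circle_energy_def)
    ultimately show ?case by auto
  next
    case (Suc j)
    then obtain g where g: "annulus_walk d R b v g" "real j * \<delta> \<le> circle_energy g" by blast
    obtain g' where g': "annulus_walk d R b v g'"
      "circle_energy g + (\<eta> / 2)\<^sup>2 * (\<integral>z. (annulus_cutoff d R (cmod (poly g z)))\<^sup>2 \<partial>circle_measure)
       \<le> circle_energy g'"
      using annulus_walk_step[OF g(1) d(1) \<eta>] by blast
    have "\<delta> \<le> (\<eta> / 2)\<^sup>2 * (\<integral>z. (annulus_cutoff d R (cmod (poly g z)))\<^sup>2 \<partial>circle_measure)"
      unfolding \<delta>_def using big[OF g(1)] by (intro mult_left_mono) auto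
    with g g' show ?case by (auto simp: algebra_simps intro!: exI[of _ g'])
  qed
  obtain j where "R\<^sup>2 < real j * \<delta>"
    using reals_Archimedean3[OF \<open>0 < \<delta>\<close>] by blast
  moreover obtain g where "annulus_walk d R b v g" "real j * \<delta> \<le> circle_energy g"
    using grow by blast
  moreover from this(1) have "circle_energy g \<le> R\<^sup>2"
    by (intro circle_energy_le) (auto simp: annulus_walk_def less_imp_le)
  ultimately show False by simp
qed

text \<open>Chebyshev's inequality for two quantities at once. Where \<open>2 d < |g| \<le> R - d\<close> the cutoff is at
  least \<open>d\<close>, and where \<open>|g| > R - d\<close> the nonnegative function \<open>ln |g| - ln d\<close>, which has mean
  \<open>ln (1 / d)\<close>, is at least \<open>ln ((R - d) / d)\<close>.\<close>

lemma annulus_walk_measure: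
  assumes walk: "annulus_walk d R b v g" and d: "0 < d" and R: "2 * d < R"
    and \<sigma>: "(\<integral>z. (annulus_cutoff d R (cmod (poly g z)))\<^sup>2 \<partial>circle_measure) \<le> \<sigma>"
  shows "1 - (\<sigma> / d\<^sup>2 + ln (1 / d) / ln ((R - d) / d))
    \<le> measure circle_measure {z \<in> sphere 0 1. cmod (poly g z) \<le> 2 * d}"
proof -
  define K where "K = {z \<in> sphere 0 1. cmod (poly g z) \<le> 2 * d}"
  define L where "L = ln ((R - d) / d)"
  have "0 < L" unfolding L_def using d R by (intro ln_gt_zero) (simp add: field_simps)
  have ann: "d < cmod (poly g z)" "cmod (poly g z) < R" if "cmod z = 1" for z
    using walk that by (auto simp: annulus_walk_def)
  have K: "K \<in> sets circle_measure"
  proof -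
    have "{z \<in> space circle_measure. cmod (poly g z) \<le> 2 * d} \<in> sets circle_measure"
      by (intro borel_measurable_le borel_measurable_circle_continuous continuous_intros)
    then show ?thesis by (simp add: K_def space_circle_measure)
  qed
  have nz: "poly g z \<noteq> 0" if "cmod z = 1" for z using ann[OF that] d by auto
  have "1 - measure circle_measure K = measure circle_measure (space circle_measure - K)"
    using circle.finite_measure_compl[OF K] by (simp add: space_circle_measure)
  also have "\<dots> = (\<integral>z. indicator (space circle_measure - K) z \<partial>circle_measure)"
    using K by simp
  also have "\<dots> \<le> (\<integral>z. (1 / d\<^sup>2) * (annulus_cutoff d R (cmod (poly g z)))\<^sup>2
      + (1 / L) * (ln (cmod (poly g z)) - ln d) \<partial>circle_measure)"
  proof (rule integral_mono)
    show "integrable circle_measure (indicator (space circle_measure - K) :: complex \<Rightarrow> real)"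
      using K by (intro integrable_real_indicator) (auto simp: circle.emeasure_finite less_top[symmetric])
    show "integrable circle_measure (\<lambda>z. (1 / d\<^sup>2) * (annulus_cutoff d R (cmod (poly g z)))\<^sup>2
      + (1 / L) * (ln (cmod (poly g z)) - ln d))"
      unfolding annulus_cutoff_def using nz
      by (intro integrable_circle_continuous continuous_intros) auto
    fix z assume "z \<in> space circle_measure"
    then have z: "cmod z = 1" by (simp add: space_circle_measure)
    define u where "u = cmod (poly g z)"
    have u: "d < u" "u < R" using ann[OF z] by (simp_all add: u_def)
    have a: "0 \<le> (1 / d\<^sup>2) * (annulus_cutoff d R u)\<^sup>2" by simp
    have l: "0 \<le> (1 / L) * (ln u - ln d)" using u d \<open>0 < L\<close> by simp
    have "1 \<le> (1 / d\<^sup>2) * (annulus_cutoff d R u)\<^sup>2 + (1 / L) * (ln u - ln d)" if "2 * d < u"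
    proof (cases "u \<le> R - d")
      case True
      have "d \<le> annulus_cutoff d R u" using True that by (simp add: annulus_cutoff_def)
      then have "d\<^sup>2 \<le> (annulus_cutoff d R u)\<^sup>2" using d by (intro power_mono) auto
      then have "1 \<le> (1 / d\<^sup>2) * (annulus_cutoff d R u)\<^sup>2" using d by (simp add: field_simps)
      with l show ?thesis by linarith
    next
      case False
      then have "L \<le> ln (u / d)" unfolding L_def using d R by (intro ln_mono divide_right_mono) auto
      also have "ln (u / d) = ln u - ln d" using u d by (intro ln_divide_pos) auto
      finally have "1 \<le> (1 / L) * (ln u - ln d)" using \<open>0 < L\<close> by (simp add: field_simps)
      with a show ?thesis by linarith
    qed
    with a l show "indicator (space circle_measure - K) z
      \<le> (1 / d\<^sup>2) * (annulus_cutoff d R (cmod (poly g z)))\<^sup>2 + (1 / L) * (ln (cmod (poly g z)) - ln d)"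
      using z by (auto simp: indicator_def K_def space_circle_measure simp flip: u_def)
  qed
  also have "\<dots> = (\<integral>z. (1 / d\<^sup>2) * (annulus_cutoff d R (cmod (poly g z)))\<^sup>2 \<partial>circle_measure)
      + (\<integral>z. (1 / L) * (ln (cmod (poly g z)) - ln d) \<partial>circle_measure)"
    unfolding annulus_cutoff_def using nz
    by (intro Bochner_Integration.integral_add integrable_circle_continuous continuous_intros) auto
  also have "(\<integral>z. (1 / L) * (ln (cmod (poly g z)) - ln d) \<partial>circle_measure) = 
     (1 / L) * (\<integral>z. ln (cmod (poly g z)) - ln d \<partial>circle_measure)"
    by (rule integral_mult_right_zero)
  also have "(\<integral>z. ln (cmod (poly g z)) - ln d \<partial>circle_measure) =
     (\<integral>z. ln (cmod (poly g z)) \<partial>circle_measure) - (\<integral>z. ln d \<partial>circle_measure)"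
    using nz by (intro Bochner_Integration.integral_diff integrable_circle_continuous continuous_intros) auto
  also have "\<dots> = ln (1 / d)"
    using walk d by (simp add: annulus_walk_def space_circle_measure ln_div)
  also have "(\<integral>z. (1 / d\<^sup>2) * (annulus_cutoff d R (cmod (poly g z)))\<^sup>2 \<partial>circle_measure) \<le> \<sigma> / d\<^sup>2"
    using \<sigma> d by (simp add: divide_right_mono)
  finally show ?thesis unfolding K_def L_def by simp
qed

text \<open>The order of the quantifiers is the point: the bound \<open>B\<close>, hence the mean square of \<open>Q\<close>, is
  fixed before the size \<open>b\<close> of the coefficients is chosen. The radius \<open>R\<close> is chosen so that the
  exit through the outer circle costs \<open>\<epsilon> / 2\<close> of the measure; the part where the walk is not yet
  stopped costs \<open>\<epsilon> / 4\<close>.\<close>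

lemma flat_polynomial_near_one:
  assumes d: "0 < d" "d < 1" and \<epsilon>: "0 < \<epsilon>" "\<epsilon> \<le> (1::real)"
  obtains B :: real where "0 < B"
    "\<And>b v. 0 < b \<Longrightarrow> \<exists>Q. (\<forall>k<v. coeff Q k = 0) \<and> (\<forall>k. cmod (coeff Q k) \<le> b) \<and>
       (\<forall>z\<in>sphere 0 1. cmod (poly Q z) \<le> B) \<and>
       1 - \<epsilon> < measure circle_measure {z \<in> sphere 0 1. cmod (poly Q z - 1) \<le> 2 * d}"
proof -
  define L where "L = 2 * ln (1 / d) / \<epsilon>"
  define R where "R = d + d * exp L"
  have ln: "0 < ln (1 / d)" using d by (intro ln_gt_zero) auto
  have L: "ln (1 / d) \<le> L" "ln (1 / d) / L = \<epsilon> / 2"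
    using \<epsilon> ln unfolding L_def by (simp_all add: field_simps) 
  have "1 / d = exp (ln (1 / d))" using d by simp
  also have "\<dots> \<le> exp L" using L by simp
  finally have "1 \<le> d * exp L" using d by (simp add: field_simps)
  then have "1 < R" using d by (simp add: R_def)
  moreover have "0 < L" using L(1) ln by linarith
  ultimately have R: "1 < R" "2 * d < R" using d by (simp_all add: R_def)
  show thesis
  proof
    show "0 < 1 + R" using R by simp
    fix b :: real and v :: nat assume "0 < b"
    define \<sigma> where "\<sigma> = d\<^sup>2 * (\<epsilon> / 4)"
    have "0 < \<sigma>" using d \<epsilon> by (simp add: \<sigma>_def)
    obtain g where g: "annulus_walk d R b v g"
      and \<sigma>: "(\<integral>z. (annulus_cutoff d R (cmod (poly g z)))\<^sup>2 \<partial>circle_measure) \<le> \<sigma>"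
      using annulus_walk_mostly_stopped[OF d R(1) \<open>0 < b\<close> \<open>0 < \<sigma>\<close>] by blast
    have "(R - d) / d = exp L" using d by (simp add: R_def)
    then have "1 - (\<epsilon> / 4 + \<epsilon> / 2) \<le> measure circle_measure {z \<in> sphere 0 1. cmod (poly g z) \<le> 2 * d}"
      using annulus_walk_measure[OF g d(1) R(2) \<sigma>] L(2) d by (simp add: \<sigma>_def)
    then have m: "1 - \<epsilon> < measure circle_measure {z \<in> sphere 0 1. cmod (poly g z) \<le> 2 * d}"
      using \<epsilon> by linarith
    have coeff: "coeff (1 - g) k = (if k = 0 then 0 else - coeff g k)" for k
      using g by (cases k) (auto simp: annulus_walk_def)
    have bound: "cmod (poly (1 - g) z) \<le> 1 + R" if "z \<in> sphere 0 1" for z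
    proof -
      have "cmod (poly g z) < R" using g that by (simp add: annulus_walk_def)
      then show ?thesis using norm_triangle_ineq4[of 1 "poly g z"] by simp
    qed
    show "\<exists>Q. (\<forall>k<v. coeff Q k = 0) \<and> (\<forall>k. cmod (coeff Q k) \<le> b) \<and>
       (\<forall>z\<in>sphere 0 1. cmod (poly Q z) \<le> 1 + R) \<and>
       1 - \<epsilon> < measure circle_measure {z \<in> sphere 0 1. cmod (poly Q z - 1) \<le> 2 * d}"
      using g bound m \<open>0 < b\<close>
      by (intro exI[of _ "1 - g"]) (auto simp: coeff annulus_walk_def simp del: coeff_diff)
  qed
qed

section \<open>The Luxemburg norm of a polynomial\<close>

lemma fourier_coeff_poly: "fourier_coeff (poly p) k = coeff p k"
proof -
  have "eval_fps (fps_of_poly p) has_fps_expansion fps_of_poly p"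
    by (rule eval_fps_has_fps_expansion) simp
  moreover have "eval_fps (fps_of_poly p) = poly p" by auto
  ultimately have "poly p has_fps_expansion fps_of_poly p" by simp
  from fps_expansion_eqI[OF this] show ?thesis by (simp add: fourier_coeff_def)
qed

lemma norm_coeff_mult_le:
  fixes q r :: "complex poly"
  assumes "\<And>k. cmod (coeff r k) \<le> b"
  shows "cmod (coeff (q * r) k) \<le> (\<Sum>j\<le>degree q. cmod (coeff q j)) * b"
proof -
  have "0 \<le> b" using assms[of 0] norm_ge_zero order_trans by blast
  have "cmod (coeff (q * r) k) \<le> (\<Sum>j\<le>k. cmod (coeff q j) * cmod (coeff r (k - j)))"
    unfolding coeff_mult by (rule order_trans[OF norm_sum]) (simp add: norm_mult)
  also have "\<dots> \<le> (\<Sum>j\<le>k. cmod (coeff q j) * b)"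
    by (intro sum_mono mult_left_mono assms) auto
  also have "\<dots> = (\<Sum>j\<le>k. cmod (coeff q j)) * b" by (simp add: sum_distrib_right)
  also have "(\<Sum>j\<le>k. cmod (coeff q j)) = (\<Sum>j\<in>{..k} \<inter> {..degree q}. cmod (coeff q j))"
    by (rule sum.mono_neutral_right) (auto intro: coeff_eq_0)
  also have "\<dots> \<le> (\<Sum>j\<le>degree q. cmod (coeff q j))" by (rule sum_mono2) auto
  finally show ?thesis using \<open>0 \<le> b\<close> by (simp add: mult_right_mono)
qed

lemma norm_poly_circle_le:
  fixes q :: "complex poly"
  assumes "cmod z = 1"
  shows "cmod (poly q z) \<le> (\<Sum>j\<le>degree q. cmod (coeff q j))"
  unfolding poly_altdef
  by (rule order_trans[OF norm_sum]) (simp add: norm_mult norm_power assms)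

text \<open>Below \<open>t0\<close> the modular is dominated by \<open>c\<close> times the square, and the sum of the squared
  coefficients is the energy by Parseval's identity.\<close>

lemma luxemburg_norm_poly_le:
  assumes \<phi>: "orlicz_function \<phi>" and "0 < \<epsilon>" "0 \<le> c"
    and small: "\<And>k. cmod (coeff p k) / \<epsilon> < t0"
    and quad: "\<And>t. 0 < t \<Longrightarrow> t < t0 \<Longrightarrow> \<phi> t \<le> c * t\<^sup>2"
    and energy: "c * circle_energy p \<le> \<epsilon>\<^sup>2"
  shows "poly p \<in> orlicz_space \<phi>" "luxemburg_norm \<phi> (poly p) \<le> \<epsilon>"
proof -
  have \<phi>0: "\<phi> 0 = 0" using \<phi> by (simp add: orlicz_function_def)
  have zero: "\<phi> (cmod (coeff p k) / \<epsilon>) = 0" if "k \<notin> {..<Suc (degree p)}" for k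
    using that by (simp add: coeff_eq_0 \<phi>0)
  have summ: "summable (\<lambda>k. \<phi> (cmod (coeff p k) / \<epsilon>))"
    by (rule summable_finite[OF finite_lessThan zero])
  have "(\<Sum>k. \<phi> (cmod (coeff p k) / \<epsilon>)) = (\<Sum>k<Suc (degree p). \<phi> (cmod (coeff p k) / \<epsilon>))"
    by (rule suminf_finite[OF finite_lessThan zero])
  also have "\<dots> \<le> (\<Sum>k<Suc (degree p). c * (cmod (coeff p k) / \<epsilon>)\<^sup>2)"
  proof (rule sum_mono)
    fix k
    show "\<phi> (cmod (coeff p k) / \<epsilon>) \<le> c * (cmod (coeff p k) / \<epsilon>)\<^sup>2"
      using quad[OF _ small, of k] \<open>0 < \<epsilon>\<close> by (cases "coeff p k = 0") (auto simp: \<phi>0)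
  qed
  also have "\<dots> = c * circle_energy p / \<epsilon>\<^sup>2"
    by (subst circle_energy_parseval[of p "Suc (degree p)"])
      (simp_all add: sum_distrib_left sum_divide_distrib power_divide del: sum.lessThan_Suc)
  also have "\<dots> \<le> 1" using energy \<open>0 < \<epsilon>\<close> by (simp add: field_simps)
  finally have le: "(\<Sum>k. \<phi> (cmod (coeff p k) / \<epsilon>)) \<le> 1" .
  show "poly p \<in> orlicz_space \<phi>"
    using summ \<open>0 < \<epsilon>\<close> by (auto simp: orlicz_space_def fourier_coeff_poly intro!: holomorphic_intros)
  show "luxemburg_norm \<phi> (poly p) \<le> \<epsilon>"
    unfolding luxemburg_norm_def fourier_coeff_poly
    by (rule cInf_lower) (use summ le \<open>0 < \<epsilon>\<close> in \<open>auto intro!: bdd_belowI[of _ 0]\<close>)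
qed

section \<open>Approximation with small Orlicz norm\<close>

theorem lemma1p1:
  fixes \<phi> :: "real \<Rightarrow> real" and \<epsilon> :: real and v :: nat and \<psi> :: "complex \<Rightarrow> complex"
  assumes "orlicz_function \<phi>"
    and "\<phi> \<in> o[at_right 0](\<lambda>t. t\<^sup>2)"
    and "\<epsilon> > 0"
    and "continuous_on (sphere 0 1) \<psi>"
  shows "\<exists>(P :: complex \<Rightarrow> complex) (a :: nat \<Rightarrow> complex) (d :: nat) (K :: complex set).
           v \<le> d \<and> P = (\<lambda>z. \<Sum>k=v..d. a k * z ^ k) \<and>
           compact K \<and> K \<subseteq> sphere 0 1 \<and> measure circle_measure K > 1 - \<epsilon> \<and>
           P \<in> orlicz_space \<phi> \<and> luxemburg_norm \<phi> P \<le> \<epsilon> \<and>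
           sup_norm_on K (\<lambda>z. P z - \<psi> z) \<le> \<epsilon>"
proof -
  obtain q M where q: "\<And>z. cmod z = 1 \<Longrightarrow> cmod (poly q z - z ^ M * \<psi> z) < \<epsilon> / 2"
    using trig_polynomial_approximation[OF assms(4), of "\<epsilon> / 2"] assms(3)
    by (metis half_gt_zero mem_sphere_0)
  \<comment> \<open>\<open>S\<close> bounds the effect of multiplication by \<open>q\<close> both on sup norms and on the largest
    coefficient; the summand \<open>1\<close> only makes it positive.\<close>
  define S where "S = (\<Sum>j\<le>degree q. cmod (coeff q j)) + 1"
  have "0 < S" unfolding S_def by (intro add_nonneg_pos sum_nonneg) auto
  have q_le: "cmod (poly q z) \<le> S" if "cmod z = 1" for z
    using norm_poly_circle_le[OF that, of q] by (simp add: S_def)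
  define \<delta> where "\<delta> = min (1 / 2) (\<epsilon> / (4 * S))"
  have \<delta>: "0 < \<delta>" "\<delta> < 1" "S * (2 * \<delta>) \<le> \<epsilon> / 2"
  proof -
    have "\<delta> \<le> \<epsilon> / (4 * S)" by (simp add: \<delta>_def)
    then show "S * (2 * \<delta>) \<le> \<epsilon> / 2" using \<open>0 < S\<close> by (simp add: field_simps)
  qed (use \<open>0 < S\<close> \<open>\<epsilon> > 0\<close> in \<open>auto simp: \<delta>_def\<close>)
  have e: "0 < min \<epsilon> 1" "min \<epsilon> 1 \<le> 1" using assms(3) by auto
  obtain B where "0 < B" and flat:
    "\<And>b v. 0 < b \<Longrightarrow> \<exists>Q. (\<forall>k<v. coeff Q k = 0) \<and> (\<forall>k. cmod (coeff Q k) \<le> b) \<and>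
       (\<forall>z\<in>sphere 0 1. cmod (poly Q z) \<le> B) \<and>
       1 - min \<epsilon> 1 < measure circle_measure {z \<in> sphere 0 1. cmod (poly Q z - 1) \<le> 2 * \<delta>}"
    using flat_polynomial_near_one[OF \<delta>(1,2) e] by blast
  \<comment> \<open>For energy at most \<open>(S B)\<^sup>2\<close> this \<open>c\<close> makes the modular at scale \<open>\<epsilon>\<close> at most \<open>1\<close>; it also
    determines how small the coefficients must be.\<close>
  define c where "c = \<epsilon>\<^sup>2 / (S * B)\<^sup>2"
  have "0 < c" using \<open>0 < S\<close> \<open>0 < B\<close> \<open>\<epsilon> > 0\<close> by (simp add: c_def)
  have "eventually (\<lambda>t. norm (\<phi> t) \<le> c * norm (t\<^sup>2)) (at_right 0)"
    using landau_o.smallD[OF assms(2) \<open>0 < c\<close>] .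
  then obtain t0 where t0: "0 < t0" and quad: "\<And>t. 0 < t \<Longrightarrow> t < t0 \<Longrightarrow> \<phi> t \<le> c * t\<^sup>2"
    unfolding eventually_at_right_field by force
  define b where "b = \<epsilon> * t0 / (2 * S)"
  have "0 < b" using \<open>0 < S\<close> \<open>\<epsilon> > 0\<close> t0 by (simp add: b_def)
  obtain Q where Q: "\<forall>k<M + v. coeff Q k = 0" "\<forall>k. cmod (coeff Q k) \<le> b"
      "\<forall>z\<in>sphere 0 1. cmod (poly Q z) \<le> B"
    and Qm: "1 - min \<epsilon> 1 < measure circle_measure {z \<in> sphere 0 1. cmod (poly Q z - 1) \<le> 2 * \<delta>}"
    using flat[OF \<open>0 < b\<close>, of "M + v"] by blast
  have Qlow: "\<And>k. k < M + v \<Longrightarrow> coeff Q k = 0" and Qb: "\<And>k. cmod (coeff Q k) \<le> b"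
    and QB: "\<And>z. cmod z = 1 \<Longrightarrow> cmod (poly Q z) \<le> B"
    using Q by simp_all
  \<comment> \<open>\<open>Q\<close> contains the factor \<open>z\<^bsup>M + v\<^esup>\<close>: \<open>z\<^bsup>M\<^esup>\<close> is spent on dividing \<open>q Q\<close> by \<open>z\<^bsup>M\<^esup>\<close>, and \<open>z\<^bsup>v\<^esup>\<close> remains.\<close>
  define Q1 where "Q1 = poly_shift (M + v) Q"
  have Q_eq: "Q = monom 1 (M + v) * Q1"
    using Qlow by (auto simp: poly_eq_iff Q1_def coeff_monom_mult coeff_poly_shift)
  define p where "p = monom 1 v * (q * Q1)"
  have p_low: "coeff p k = 0" if "k < v" for k
    using that by (simp add: p_def coeff_monom_mult)
  have pb: "cmod (coeff p k) \<le> S * b" for k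
  proof (cases "k < v")
    case True
    then show ?thesis using p_low \<open>0 < S\<close> \<open>0 < b\<close> by simp
  next
    case False
    have "cmod (coeff (q * Q1) (k - v)) \<le> (\<Sum>j\<le>degree q. cmod (coeff q j)) * b"
      by (rule norm_coeff_mult_le) (simp add: Q1_def coeff_poly_shift Qb)
    also have "\<dots> \<le> S * b" using \<open>0 < b\<close> by (simp add: S_def)
    finally show ?thesis using False by (simp add: p_def coeff_monom_mult)
  qed
  have zp: "z ^ M * poly p z = poly q z * poly Q z" for z
    by (simp add: p_def Q_eq poly_monom power_add)
  have p_norm: "cmod (poly p z) = cmod (poly q z) * cmod (poly Q z)" if "cmod z = 1" for z
    using arg_cong[OF zp[of z], of cmod] that by (simp add: norm_mult norm_power)
  have "circle_energy p \<le> (S * B)\<^sup>2"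
    using \<open>0 < S\<close> by (intro circle_energy_le) (auto simp: p_norm intro!: mult_mono q_le QB)
  then have "c * circle_energy p \<le> c * (S * B)\<^sup>2"
    using \<open>0 < c\<close> by (intro mult_left_mono) auto
  also have "\<dots> = \<epsilon>\<^sup>2" using \<open>0 < S\<close> \<open>0 < B\<close> by (simp add: c_def)
  finally have energy: "c * circle_energy p \<le> \<epsilon>\<^sup>2" .
  have small: "cmod (coeff p k) / \<epsilon> < t0" for k
  proof -
    have "cmod (coeff p k) \<le> \<epsilon> * t0 / 2" using pb[of k] \<open>0 < S\<close> by (simp add: b_def)
    also have "\<dots> < \<epsilon> * t0" using \<open>\<epsilon> > 0\<close> t0 by simp
    finally show ?thesis using \<open>\<epsilon> > 0\<close> by (simp add: field_simps)
  qed
  note norm_p = luxemburg_norm_poly_le[OF assms(1,3) less_imp_le[OF \<open>0 < c\<close>] small quad energy]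
  define K where "K = {z \<in> sphere 0 1. cmod (poly Q z - 1) \<le> 2 * \<delta>}"
  have close: "cmod (poly p z - \<psi> z) \<le> \<epsilon>" if "z \<in> K" for z
  proof -
    have z: "cmod z = 1" and near: "cmod (poly Q z - 1) \<le> 2 * \<delta>" using that by (auto simp: K_def)
    have "cmod (poly p z - \<psi> z) = cmod (z ^ M * (poly p z - \<psi> z))"
      using z by (simp add: norm_mult norm_power)
    also have "z ^ M * (poly p z - \<psi> z) = poly q z * (poly Q z - 1) + (poly q z - z ^ M * \<psi> z)"
      unfolding right_diff_distrib zp by (simp add: algebra_simps)
    also have "cmod \<dots> \<le> cmod (poly q z) * cmod (poly Q z - 1) + cmod (poly q z - z ^ M * \<psi> z)"
      by (rule order_trans[OF norm_triangle_ineq]) (simp add: norm_mult)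
    also have "\<dots> \<le> S * (2 * \<delta>) + \<epsilon> / 2"
      using q_le[OF z] near q[OF z] \<open>0 < S\<close> by (intro add_mono mult_mono) auto
    also have "\<dots> \<le> \<epsilon>" using \<delta>(3) by simp
    finally show ?thesis .
  qed
  have m: "1 - min \<epsilon> 1 < measure circle_measure K" using Qm by (simp add: K_def)
  have "K \<noteq> {}" using m e by auto
  have sup: "sup_norm_on K (\<lambda>z. poly p z - \<psi> z) \<le> \<epsilon>"
    unfolding sup_norm_on_def using \<open>K \<noteq> {}\<close> close by (intro cSUP_least) auto
  have "compact K"
  proof -
    have "K = sphere 0 1 \<inter> {z. cmod (poly Q z - 1) \<le> 2 * \<delta>}" by (auto simp: K_def)
    also have "compact \<dots>" 
      by (intro compact_Int_closed closed_Collect_le continuous_intros) auto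
    finally show ?thesis .
  qed
  have P: "poly p = (\<lambda>z. \<Sum>k=v..max v (degree p). coeff p k * z ^ k)"
  proof
    fix z
    have "poly p z = (\<Sum>k\<le>degree p. coeff p k * z ^ k)" by (rule poly_altdef)
    also have "\<dots> = (\<Sum>k\<le>max v (degree p). coeff p k * z ^ k)"
      by (rule sum.mono_neutral_left) (auto simp: coeff_eq_0)
    also have "\<dots> = (\<Sum>k=v..max v (degree p). coeff p k * z ^ k)"
      by (rule sum.mono_neutral_right) (auto simp: p_low)
    finally show "poly p z = (\<Sum>k=v..max v (degree p). coeff p k * z ^ k)" .
  qed
  have "v \<le> max v (degree p)" "K \<subseteq> sphere 0 1" "1 - \<epsilon> < measure circle_measure K"
    using m by (auto simp: K_def)
  then show ?thesis using P \<open>compact K\<close> norm_p sup by blast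
qed

end
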